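(* Let $a>b>0$ and let $K_e\subset\mathbb{R}^3$ be the elliptic cone $$(x^3)^2=\frac{(x^1)^2}{a^2}+\frac{(x^2)^2}{b^2},\qquad x^3>0 .$$ Let $c_1>0$, $c_2>0$. Then the number of reflections of any billiard trajectory inside $K_e$ along which the first integrals take the values $I_1=c_1$ and $I_2=c_2$ is at most $$N_{c_1,c_2}=\left\lceil \frac{\pi}{\arcsin\dfrac{2ab\sqrt{c_1c_2}}{a^2(b^2+1)c_1+(b^2+1)c_2}}\right\rceil .$$
   Context: The billiard inside $K_e$: a point moves with unit speed along straight segments in the convex region $\{x^3>\sqrt{(x^1)^2/a^2+(x^2)^2/b^2}\}$ bounded by $K_e$ and, on hitting $K_e$ at a point $p$, its velocity is reflected in the tangent plane $T_pK_e$ (tangential component preserved, normal component reversed). For a point with position $x=(x^1,x^2,x^3)$ and velocity $v=(v^1,v^2,v^3)$, $\|v\|=1$, put $m_{i,j}=x^iv^j-x^jv^i$ for $i<j$, and $$I_1=m_{1,2}^2+m_{1,3}^2+m_{2,3}^2,\qquad I_2=a^2m_{2,3}^2+b^2m_{1,3}^2-m_{1,2}^2 .$$ $I_1$ and $I_2$ are first integrals of this billiard, i.e. they are constant along every billiard trajectory (including at reflections). $\lceil x\rceil$ denotes the smallest integer greater than or equal to $x$. *)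

theory Defs
  imports "HOL-Analysis.Analysis"
begin

definition elliptic_cone :: "real \<Rightarrow> real \<Rightarrow> (real^3) set" where
  "elliptic_cone a b =
     {p. (p$3)\<^sup>2 = (p$1)\<^sup>2 / a\<^sup>2 + (p$2)\<^sup>2 / b\<^sup>2 \<and> p$3 > 0}"

definition cone_interior :: "real \<Rightarrow> real \<Rightarrow> (real^3) set" where
  "cone_interior a b = {p. p$3 > sqrt ((p$1)\<^sup>2 / a\<^sup>2 + (p$2)\<^sup>2 / b\<^sup>2)}"

(* Half the gradient at p of (x^1)^2/a^2 + (x^2)^2/b^2 - (x^3)^2; for p on the cone it spans
   the orthogonal complement of the tangent plane at p. *)
definition cone_normal :: "real \<Rightarrow> real \<Rightarrow> real^3 \<Rightarrow> real^3" where
  "cone_normal a b p = vector [p$1 / a\<^sup>2, p$2 / b\<^sup>2, - p$3]"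

(* Reflection in the plane orthogonal to n (n nonzero, not necessarily of unit length). *)
definition reflect :: "real^3 \<Rightarrow> real^3 \<Rightarrow> real^3" where
  "reflect n u = u - (2 * (u \<bullet> n) / (n \<bullet> n)) *\<^sub>R n"

definition moves_straight_at :: "real \<Rightarrow> real \<Rightarrow> (real \<Rightarrow> real^3) \<Rightarrow> real \<Rightarrow> bool" where
  "moves_straight_at a b x t \<longleftrightarrow>
     x t \<in> cone_interior a b \<and>
     (\<exists>u. norm u = 1 \<and> (\<forall>\<^sub>F s in at t. x s = x t + (s - t) *\<^sub>R u))"

definition reflects_at :: "real \<Rightarrow> real \<Rightarrow> (real \<Rightarrow> real^3) \<Rightarrow> real \<Rightarrow> bool" where
  "reflects_at a b x t \<longleftrightarrow>
     x t \<in> elliptic_cone a b \<and>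
     (\<exists>u. norm u = 1 \<and>
        (\<forall>\<^sub>F s in at_left t. x s \<in> cone_interior a b \<and> x s = x t + (s - t) *\<^sub>R u) \<and>
        (\<forall>\<^sub>F s in at_right t. x s \<in> cone_interior a b \<and>
           x s = x t + (s - t) *\<^sub>R reflect (cone_normal a b (x t)) u))"

(* The time domain J is an arbitrary nonempty open interval, bounded or not. Reflection times
   are isolated in J by the local conditions, but nothing prevents them a priori from being
   infinite in number or accumulating at an end of J. The apex lies in neither
   cone_interior nor elliptic_cone, so a trajectory cannot pass through it. *)
definition billiard_trajectory ::
    "real \<Rightarrow> real \<Rightarrow> real set \<Rightarrow> (real \<Rightarrow> real^3) \<Rightarrow> bool" where
  "billiard_trajectory a b J x \<longleftrightarrow>
     J \<noteq> {} \<and> open J \<and> is_interval J \<and>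
     (\<forall>t\<in>J. moves_straight_at a b x t \<or> reflects_at a b x t)"

definition reflection_times ::
    "real \<Rightarrow> real \<Rightarrow> real set \<Rightarrow> (real \<Rightarrow> real^3) \<Rightarrow> real set" where
  "reflection_times a b J x = {t \<in> J. reflects_at a b x t}"

definition ang_mom :: "real^3 \<Rightarrow> real^3 \<Rightarrow> 3 \<Rightarrow> 3 \<Rightarrow> real" where
  "ang_mom x v i j = x$i * v$j - x$j * v$i"

definition I1 :: "real^3 \<Rightarrow> real^3 \<Rightarrow> real" where
  "I1 x v = (ang_mom x v 1 2)\<^sup>2 + (ang_mom x v 1 3)\<^sup>2 + (ang_mom x v 2 3)\<^sup>2"

definition I2 :: "real \<Rightarrow> real \<Rightarrow> real^3 \<Rightarrow> real^3 \<Rightarrow> real" where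
  "I2 a b x v =
     a\<^sup>2 * (ang_mom x v 2 3)\<^sup>2 + b\<^sup>2 * (ang_mom x v 1 3)\<^sup>2 - (ang_mom x v 1 2)\<^sup>2"

(* The velocity is the derivative of the position; it exists exactly away from the
   reflection times. *)
definition integrals_along ::
    "real \<Rightarrow> real \<Rightarrow> real set \<Rightarrow> (real \<Rightarrow> real^3) \<Rightarrow> real \<Rightarrow> real \<Rightarrow> bool" where
  "integrals_along a b J x c1 c2 \<longleftrightarrow>
     (\<forall>t \<in> J - reflection_times a b J x.
        I1 (x t) (vector_derivative x (at t)) = c1 \<and>
        I2 a b (x t) (vector_derivative x (at t)) = c2)"

end

theory Submission
  imports Defs
begin

text \<open>
  The idea is to watch the trajectory from the apex. The cone is homogeneous, so its normal at a
  point \<open>p\<close> is orthogonal to \<open>p\<close>, and a reflection changes neither \<open>\<bar>x\<bar>\<close> nor \<open>x \<bullet> v\<close>. Hence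
  \<open>\<bar>x(t)\<bar>\<^sup>2\<close> is given during the whole motion by the same quadratic polynomial as on a single
  line: \<open>\<bar>x(t)\<bar>\<^sup>2 = (t - t0)\<^sup>2 + c1\<close> (\<open>norm_sq_trajectory\<close>). On each straight piece the direction of
  \<open>x\<close> turns exactly as much as \<open>\<theta>(t) = arctan ((t - t0) / sqrt c1)\<close> grows, and the values of
  \<open>\<theta>\<close> lie in an open interval of length \<open>\<pi>\<close>. So the total turning is less than \<open>\<pi>\<close>, however
  many reflections occur.

  It remains to bound below the angle \<open>\<phi>\<close> between two consecutive reflection points \<open>p\<close>, \<open>q\<close>, seen
  from the apex. Let \<open>Q\<close> be the quadratic form that vanishes on the cone and \<open>B\<close> its polar form; with
  the given normal vector, \<open>B(p,q) = p \<bullet> cone_normal a b q\<close>. As \<open>Q(p) = Q(q) = 0\<close>, the value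
  \<open>I2 = c2\<close> determines \<open>\<bar>B(p,q)\<bar>\<close> and the value \<open>I1 = c1\<close> determines \<open>\<bar>p \<times> q\<bar>\<close>, both in terms of
  the length of the chord. For unit vectors \<open>p\<close>, \<open>q\<close> we have \<open>Q(p \<plusminus> q) = \<plusminus> 2 B(p,q)\<close>, and the
  eigenvalue bounds \<open>- \<bar>w\<bar>\<^sup>2 \<le> Q(w) \<le> \<bar>w\<bar>\<^sup>2 / b\<^sup>2\<close> compare this with
  \<open>\<bar>p + q\<bar>\<^sup>2 = 2 + 2 cos \<phi>\<close> and \<open>\<bar>p - q\<bar>\<^sup>2 = 2 - 2 cos \<phi>\<close>, whose product is \<open>4 sin\<^sup>2 \<phi>\<close>. This yields
  \<open>2 \<bar>B(p,q)\<bar> \<le> (1 + 1/b\<^sup>2) sin\<^sup>2 \<phi>\<close> (\<open>isotropic_unit_chord\<close>), and eliminating the length of the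
  chord turns it into a lower bound for \<open>sin \<phi>\<close> that is at least the argument of the arcsine in
  the theorem (\<open>chord_bound\<close>).

  Thus the values of \<open>\<theta>\<close> at the reflection times are separated by at least the arcsine, inside an
  open interval of length \<open>\<pi>\<close>. Cutting this interval into cells as long as the arcsine puts at most
  one reflection in each cell (\<open>card_separated_le\<close>). This gives the bound and the finiteness at once,
  with no separate argument against reflections that accumulate at an end of the time domain.
\<close>

section \<open>The quadratic form of the cone\<close>

lemma inner_cone_normal:
  "p \<bullet> cone_normal a b q = p$1 * q$1 / a\<^sup>2 + p$2 * q$2 / b\<^sup>2 - p$3 * q$3"
  by (simp add: cone_normal_def inner_vec_def sum_3)

lemma cone_normal_scaleR: "cone_normal a b (r *\<^sub>R p) = r *\<^sub>R cone_normal a b p"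
  by (simp add: cone_normal_def vec_eq_iff forall_3)

lemma elliptic_cone_isotropic:
  "p \<in> elliptic_cone a b \<Longrightarrow> p \<bullet> cone_normal a b p = 0"
  by (simp add: elliptic_cone_def inner_cone_normal power2_eq_square)

lemma norm_sq_3: "(norm (p::real^3))\<^sup>2 = (p$1)\<^sup>2 + (p$2)\<^sup>2 + (p$3)\<^sup>2"
  unfolding power2_norm_eq_inner inner_vec_def sum_3 by (simp add: power2_eq_square)

lemma cone_form_ge: "- (norm p)\<^sup>2 \<le> p \<bullet> cone_normal a b p"
proof -
  have "0 \<le> (p$1)\<^sup>2 / a\<^sup>2" "0 \<le> (p$2)\<^sup>2 / b\<^sup>2" by simp_all
  moreover have "0 \<le> (p$1)\<^sup>2" "0 \<le> (p$2)\<^sup>2" by simp_all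
  ultimately show ?thesis
    unfolding inner_cone_normal norm_sq_3 power2_eq_square[symmetric] by linarith
qed

lemma cone_form_le:
  assumes "a > b" "b > 0"
  shows "p \<bullet> cone_normal a b p \<le> (norm p)\<^sup>2 / b\<^sup>2"
proof -
  have "(p$1)\<^sup>2 / a\<^sup>2 \<le> (p$1)\<^sup>2 / b\<^sup>2"
    using assms by (intro divide_left_mono power_mono) auto
  moreover have "0 \<le> (p$3)\<^sup>2 / b\<^sup>2" "0 \<le> (p$3)\<^sup>2" by simp_all
  ultimately show ?thesis
    unfolding inner_cone_normal norm_sq_3 power2_eq_square[symmetric] add_divide_distrib by linarith
qed

text \<open>
  With \<open>B\<close> the polar value and \<open>c = p \<bullet> q\<close>, the form takes the values \<open>2 B\<close> and \<open>- 2 B\<close> at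
  \<open>p + q\<close> and \<open>p - q\<close>. The nonpositive one is at least \<open>- n1\<close> and the other at most \<open>n2 / b\<^sup>2\<close>, where
  \<open>n1\<close>, \<open>n2\<close> are the squared lengths of these two vectors in an order that depends on the sign of
  \<open>B\<close>. Since \<open>n1 + n2 = 4\<close>, weighting the two estimates by \<open>n2\<close> and \<open>n1\<close> bounds \<open>8 \<bar>B\<bar>\<close> by
  \<open>(1 + 1/b\<^sup>2) n1 n2\<close>, and \<open>n1 n2 = 4 (1 - c\<^sup>2)\<close>.
\<close>

lemma isotropic_unit_chord:
  assumes "a > b" "b > 0"
    and p: "p \<bullet> cone_normal a b p = 0" "norm p = 1"
    and q: "q \<bullet> cone_normal a b q = 0" "norm q = 1"
  shows "2 * \<bar>p \<bullet> cone_normal a b q\<bar> \<le> (1 + 1 / b\<^sup>2) * (1 - (p \<bullet> q)\<^sup>2)"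
proof -
  define B where "B = p \<bullet> cone_normal a b q"
  define c where "c = p \<bullet> q"
  have main: "8 * \<bar>B\<bar> \<le> (1 + 1 / b\<^sup>2) * (n1 * n2)"
    if "n1 + n2 = 4" "2 * \<bar>B\<bar> \<le> n1" "2 * \<bar>B\<bar> \<le> n2 / b\<^sup>2" for n1 n2
  proof -
    have "0 \<le> n1" "0 \<le> n2 / b\<^sup>2" using that(2,3) by linarith+
    then have "0 \<le> n2" using \<open>b > 0\<close> by (simp add: zero_le_divide_iff)
    have "8 * \<bar>B\<bar> = 2 * \<bar>B\<bar> * n1 + 2 * \<bar>B\<bar> * n2"
      using that(1) by (simp add: distrib_left[symmetric])
    also have "\<dots> \<le> n2 / b\<^sup>2 * n1 + n1 * n2"
      using that \<open>0 \<le> n1\<close> \<open>0 \<le> n2\<close> by (intro add_mono mult_right_mono) auto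
    finally show ?thesis by (simp add: algebra_simps)
  qed
  have sum: "(norm (p + q))\<^sup>2 = 2 + 2 * c" and diff: "(norm (p - q))\<^sup>2 = 2 - 2 * c"
    using p q by (simp_all add: c_def power2_norm_eq_inner inner_add inner_diff inner_commute norm_eq_1)
  have Qsum: "(p + q) \<bullet> cone_normal a b (p + q) = 2 * B"
    and Qdiff: "(p - q) \<bullet> cone_normal a b (p - q) = - (2 * B)"
    using p(1) q(1) unfolding B_def inner_cone_normal
    by (simp_all add: algebra_simps add_divide_distrib diff_divide_distrib)
  have bounds: "- (2 + 2 * c) \<le> 2 * B" "2 * B \<le> (2 + 2 * c) / b\<^sup>2"
    "- (2 - 2 * c) \<le> - (2 * B)" "- (2 * B) \<le> (2 - 2 * c) / b\<^sup>2"
    using cone_form_ge[of "p + q" a b] cone_form_le[OF assms(1,2), of "p + q"]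
      cone_form_ge[of "p - q" a b] cone_form_le[OF assms(1,2), of "p - q"]
    unfolding sum diff Qsum Qdiff by auto
  have "8 * \<bar>B\<bar> \<le> (1 + 1 / b\<^sup>2) * ((2 + 2 * c) * (2 - 2 * c))"
  proof (cases "B \<le> 0")
    case True
    then show ?thesis using main[of "2 + 2 * c" "2 - 2 * c"] bounds by simp
  next
    case False
    then show ?thesis using main[of "2 - 2 * c" "2 + 2 * c"] bounds
      by (simp add: mult.commute)
  qed
  also have "(2 + 2 * c) * (2 - 2 * c) = 4 * (1 - c\<^sup>2)"
    by (simp add: power2_eq_square algebra_simps)
  finally show ?thesis by (simp add: B_def c_def algebra_simps)
qed

lemma isotropic_chord:
  assumes "a > b" "b > 0"
    and p: "p \<bullet> cone_normal a b p = 0" "p \<noteq> 0"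
    and q: "q \<bullet> cone_normal a b q = 0" "q \<noteq> 0"
  shows "2 * \<bar>p \<bullet> cone_normal a b q\<bar> * (norm p * norm q)
    \<le> (1 + 1 / b\<^sup>2) * ((norm p)\<^sup>2 * (norm q)\<^sup>2 - (p \<bullet> q)\<^sup>2)"
proof -
  define N where "N = norm p * norm q"
  have N: "N > 0" using p q by (simp add: N_def)
  have "2 * \<bar>sgn p \<bullet> cone_normal a b (sgn q)\<bar> \<le> (1 + 1 / b\<^sup>2) * (1 - (sgn p \<bullet> sgn q)\<^sup>2)"
    using p q by (intro isotropic_unit_chord assms(1,2)) (simp_all add: sgn_div_norm cone_normal_scaleR)
  moreover have "\<bar>sgn p \<bullet> cone_normal a b (sgn q)\<bar> = \<bar>p \<bullet> cone_normal a b q\<bar> / N"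
    using N by (simp add: sgn_div_norm cone_normal_scaleR N_def abs_mult divide_inverse)
  moreover have "(sgn p \<bullet> sgn q)\<^sup>2 = (p \<bullet> q)\<^sup>2 / N\<^sup>2"
    by (simp add: sgn_div_norm N_def power_mult_distrib divide_inverse power_inverse)
  ultimately have "2 * (\<bar>p \<bullet> cone_normal a b q\<bar> / N) \<le> (1 + 1 / b\<^sup>2) * (1 - (p \<bullet> q)\<^sup>2 / N\<^sup>2)"
    by simp
  then have "2 * (\<bar>p \<bullet> cone_normal a b q\<bar> / N) * N\<^sup>2 \<le> (1 + 1 / b\<^sup>2) * (1 - (p \<bullet> q)\<^sup>2 / N\<^sup>2) * N\<^sup>2"
    by (intro mult_right_mono) auto
  moreover have "2 * (\<bar>p \<bullet> cone_normal a b q\<bar> / N) * N\<^sup>2 = 2 * \<bar>p \<bullet> cone_normal a b q\<bar> * N"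
    using N by (simp add: power2_eq_square)
  moreover have "(1 + 1 / b\<^sup>2) * (1 - (p \<bullet> q)\<^sup>2 / N\<^sup>2) * N\<^sup>2 = (1 + 1 / b\<^sup>2) * (N\<^sup>2 - (p \<bullet> q)\<^sup>2)"
    using N by (simp add: right_diff_distrib left_diff_distrib)
  ultimately have "2 * \<bar>p \<bullet> cone_normal a b q\<bar> * N \<le> (1 + 1 / b\<^sup>2) * (N\<^sup>2 - (p \<bullet> q)\<^sup>2)"
    by linarith
  then show ?thesis unfolding N_def power_mult_distrib .
qed

section \<open>The first integrals\<close>

lemma I1_eq: "I1 x v = (norm x)\<^sup>2 * (norm v)\<^sup>2 - (x \<bullet> v)\<^sup>2"
  unfolding I1_def ang_mom_def norm_sq_3 inner_vec_def sum_3
  by (simp add: power2_eq_square algebra_simps)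

text \<open>
  Up to the factor \<open>- a\<^sup>2 b\<^sup>2\<close>, the second integral is the Gram determinant of \<open>x\<close> and \<open>v\<close> for the
  quadratic form of the cone, just as the first one is their Euclidean Gram determinant. At a point
  of the cone it therefore determines the polar value of \<open>x\<close> and \<open>v\<close> up to sign.
\<close>

lemma I2_eq:
  assumes "a \<noteq> 0" "b \<noteq> 0"
  shows "I2 a b x v = a\<^sup>2 * b\<^sup>2 *
    ((x \<bullet> cone_normal a b v)\<^sup>2 - (x \<bullet> cone_normal a b x) * (v \<bullet> cone_normal a b v))"
proof -
  have "a\<^sup>2 * b\<^sup>2 * ((x \<bullet> cone_normal a b v)\<^sup>2 - (x \<bullet> cone_normal a b x) * (v \<bullet> cone_normal a b v))
    = I2 a b x v"
    using assms unfolding I2_def ang_mom_def inner_cone_normal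
    by (simp add: field_simps power2_eq_square)
  then show ?thesis by simp
qed

lemma ang_mom_shift: "ang_mom (x + s *\<^sub>R v) v i j = ang_mom x v i j"
  by (simp add: ang_mom_def algebra_simps)

lemma I1_shift: "I1 (x + s *\<^sub>R v) v = I1 x v"
  and I2_shift: "I2 a b (x + s *\<^sub>R v) v = I2 a b x v"
  by (simp_all add: I1_def I2_def ang_mom_shift)

text \<open>
  The right-hand side is the sine of the angle under which the apex sees the chord from \<open>p\<close> to
  \<open>p + l u\<close>: its numerator is \<open>\<bar>p \<times> (p + l u)\<bar> = l sqrt c1\<close>. Writing \<open>q\<close> for the second endpoint,
  \<open>I2 = c2\<close> means \<open>a b \<bar>B(p,q)\<bar> = l sqrt c2\<close>, so \<open>isotropic_chord\<close> reads
  \<open>2 b sqrt c2 \<bar>p\<bar> \<bar>q\<bar> \<le> a (b\<^sup>2 + 1) l c1\<close>. The claim follows already with the summand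
  \<open>(b\<^sup>2 + 1) c2\<close> of the denominator replaced by zero.
\<close>

lemma chord_bound:
  assumes ab: "a > b" "b > 0" and c: "c1 > 0" "c2 > 0" and l: "l > 0"
    and p: "p \<in> elliptic_cone a b" and cone_q: "p + l *\<^sub>R u \<in> elliptic_cone a b"
    and I: "I1 p u = c1" "I2 a b p u = c2"
  shows "2 * a * b * sqrt (c1 * c2) / (a\<^sup>2 * (b\<^sup>2 + 1) * c1 + (b\<^sup>2 + 1) * c2)
    \<le> l * sqrt c1 / (norm p * norm (p + l *\<^sub>R u))"
proof -
  define q where "q = p + l *\<^sub>R u"
  define N where "N = norm p * norm q"
  define B where "B = \<bar>p \<bullet> cone_normal a b q\<bar>"
  have a: "a > 0" using ab by simp
  have nz: "p \<noteq> 0" "q \<noteq> 0" using p cone_q unfolding q_def[symmetric] by (auto simp: elliptic_cone_def)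
  then have N: "N > 0" by (simp add: N_def)
  have iso: "p \<bullet> cone_normal a b p = 0" "q \<bullet> cone_normal a b q = 0"
    using elliptic_cone_isotropic p cone_q by (auto simp: q_def)
  have Bu: "p \<bullet> cone_normal a b q = l * (p \<bullet> cone_normal a b u)"
    using iso(1) by (simp add: q_def inner_cone_normal algebra_simps add_divide_distrib)
  have "c2 = (a * b * \<bar>p \<bullet> cone_normal a b u\<bar>)\<^sup>2"
    using I(2) I2_eq[of a b p u] ab iso by (simp add: power_mult_distrib)
  then have "sqrt c2 = a * b * \<bar>p \<bullet> cone_normal a b u\<bar>"
    using a ab by simp
  then have B: "a * b * B = l * sqrt c2"
    unfolding B_def Bu using l by (simp add: abs_mult)
  have "(norm p)\<^sup>2 * (norm q)\<^sup>2 - (p \<bullet> q)\<^sup>2 = I1 p q" by (simp add: I1_eq)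
  also have "I1 p q = l\<^sup>2 * I1 p u"
    unfolding I1_def ang_mom_def q_def by (simp add: power2_eq_square algebra_simps)
  finally have G: "(norm p)\<^sup>2 * (norm q)\<^sup>2 - (p \<bullet> q)\<^sup>2 = l\<^sup>2 * c1" using I by simp
  have "2 * B * N \<le> (1 + 1 / b\<^sup>2) * (l\<^sup>2 * c1)"
    using isotropic_chord[OF ab iso(1) nz(1) iso(2) nz(2)] G by (simp add: B_def N_def)
  then have "a * b\<^sup>2 * (2 * B * N) \<le> a * b\<^sup>2 * ((1 + 1 / b\<^sup>2) * (l\<^sup>2 * c1))"
    using a by (intro mult_left_mono) auto
  also have "a * b\<^sup>2 * ((1 + 1 / b\<^sup>2) * (l\<^sup>2 * c1)) = a * (b\<^sup>2 + 1) * l\<^sup>2 * c1"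
    using ab by (simp add: field_simps)
  also have "a * b\<^sup>2 * (2 * B * N) = 2 * b * (a * b * B) * N"
    by (simp add: power2_eq_square)
  finally have "l * (2 * b * sqrt c2 * N) \<le> l * (a * (b\<^sup>2 + 1) * l * c1)"
    unfolding B by (simp add: power2_eq_square mult_ac)
  then have *: "2 * b * sqrt c2 * N \<le> a * (b\<^sup>2 + 1) * l * c1"
    using l by simp
  have "2 * a * b * sqrt (c1 * c2) / (a\<^sup>2 * (b\<^sup>2 + 1) * c1 + (b\<^sup>2 + 1) * c2)
     \<le> 2 * a * b * sqrt (c1 * c2) / (a\<^sup>2 * (b\<^sup>2 + 1) * c1)"
    using a ab c by (intro divide_left_mono) (auto intro!: mult_pos_pos add_pos_pos add_nonneg_pos)
  also have "\<dots> \<le> l * sqrt c1 / N"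
  proof -
    have "2 * a * b * sqrt (c1 * c2) * N = (a * sqrt c1) * (2 * b * sqrt c2 * N)"
      by (simp add: real_sqrt_mult)
    also have "\<dots> \<le> (a * sqrt c1) * (a * (b\<^sup>2 + 1) * l * c1)"
      using * a c by (intro mult_left_mono) auto
    also have "\<dots> = l * sqrt c1 * (a\<^sup>2 * (b\<^sup>2 + 1) * c1)"
      by (simp add: power2_eq_square)
    finally show ?thesis
      using N a c by (simp add: pos_divide_le_eq pos_le_divide_eq add_nonneg_pos)
  qed
  finally show ?thesis by (simp add: N_def q_def)
qed

text \<open>
  On \<open>(0, 1]\<close> the arcsine is positive and increasing. The upper bound is the inequality of
  arithmetic and geometric means for \<open>a\<^sup>2 c1\<close> and \<open>c2\<close>, together with \<open>b \<le> b\<^sup>2 + 1\<close>.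
\<close>

lemma bound_argument_range:
  fixes a b c1 c2 :: real
  assumes "a > 0" "b > 0" "c1 > 0" "c2 > 0"
  defines "K \<equiv> 2 * a * b * sqrt (c1 * c2) / (a\<^sup>2 * (b\<^sup>2 + 1) * c1 + (b\<^sup>2 + 1) * c2)"
  shows "0 < K" "K \<le> 1"
proof -
  have D: "0 < a\<^sup>2 * (b\<^sup>2 + 1) * c1 + (b\<^sup>2 + 1) * c2"
    using assms by (intro add_pos_pos mult_pos_pos) (auto simp: add_nonneg_pos)
  show "0 < K" using assms D by (simp add: K_def)
  have "2 * (a * sqrt c1) * sqrt c2 \<le> (a * sqrt c1)\<^sup>2 + (sqrt c2)\<^sup>2"
    by (rule sum_squares_bound)
  then have 1: "2 * a * sqrt (c1 * c2) \<le> a\<^sup>2 * c1 + c2"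
    using assms by (simp add: power_mult_distrib real_sqrt_mult)
  have "0 \<le> (b - 1)\<^sup>2" by simp
  then have 2: "b \<le> b\<^sup>2 + 1"
    using \<open>b > 0\<close> by (simp add: power2_eq_square algebra_simps)
  have "b * (2 * a * sqrt (c1 * c2)) \<le> (b\<^sup>2 + 1) * (a\<^sup>2 * c1 + c2)"
    using assms 1 2 by (intro mult_mono) auto
  then show "K \<le> 1" using D by (simp add: K_def algebra_simps)
qed

section \<open>Locally affine functions\<close>

lemma diff_scaleR_eq_iff:
  fixes p q u :: "'a::real_vector"
  shows "p - s *\<^sub>R u = q - t *\<^sub>R u \<longleftrightarrow> p = q + (s - t) *\<^sub>R u"
  by (simp add: algebra_simps)

lemma vector_derivative_locally_affine:
  fixes f :: "real \<Rightarrow> 'a::real_normed_vector"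
  assumes "\<forall>\<^sub>F s in nhds t. f s = c + (s - t0) *\<^sub>R u"
  shows "vector_derivative f (at t) = u"
proof -
  have "((\<lambda>s. c + (s - t0) *\<^sub>R u) has_vector_derivative u) (at t)"
    by (auto intro!: derivative_eq_intros)
  moreover have "(f has_vector_derivative u) (at t)
      = ((\<lambda>s. c + (s - t0) *\<^sub>R u) has_vector_derivative u) (at t)"
    using assms eventually_nhds_x_imp_x[OF assms]
    by (intro has_vector_derivative_cong_ev) (auto elim: eventually_mono)
  ultimately show ?thesis by (simp add: vector_derivative_at)
qed

text \<open>
  The slope is locally constant, hence constant on a connected set; subtracting the linear part
  leaves a function to which the same argument applies. The lemma serves twice: for the position on
  a time interval free of reflections, and for \<open>\<bar>x(t)\<bar>\<^sup>2 - t\<^sup>2\<close>, which is affine near every time,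
  reflections included.
\<close>

lemma locally_affine_imp_affine:
  fixes f :: "real \<Rightarrow> 'a::real_normed_vector"
  assumes "connected J"
    and loc: "\<And>t. t \<in> J \<Longrightarrow> \<exists>u. \<forall>\<^sub>F s in nhds t. f s = f t + (s - t) *\<^sub>R u"
  shows "\<exists>u. \<forall>s\<in>J. \<forall>t\<in>J. f s = f t + (s - t) *\<^sub>R u"
proof -
  define D where "D t = vector_derivative f (at t)" for t
  have der: "D t = u" if "\<forall>\<^sub>F s in nhds t. f s = c + (s - t0) *\<^sub>R u" for t c t0 u
    unfolding D_def using that by (rule vector_derivative_locally_affine)
  have nbhd: "\<forall>\<^sub>F s in nhds t. D s = D t \<and> f s = f t + (s - t) *\<^sub>R D t" if t: "t \<in> J" for t
  proof -
    obtain u where u: "\<forall>\<^sub>F s in nhds t. f s = f t + (s - t) *\<^sub>R u" using loc[OF t] by blast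
    \<comment> \<open>The same affine formula for \<open>f\<close> is valid near every \<open>r\<close> close to \<open>t\<close>, so it gives the
      derivative there too.\<close>
    then have "\<forall>\<^sub>F r in nhds t. \<forall>\<^sub>F s in nhds r. f s = f t + (s - t) *\<^sub>R u"
      by (simp only: eventually_eventually)
    then have "\<forall>\<^sub>F r in nhds t. D r = u"
      by (rule eventually_mono) (rule der)
    with u show ?thesis unfolding der[OF u] by eventually_elim auto
  qed
  have const: "g s = g t" if "s \<in> J" "t \<in> J" and g: "\<And>t. t \<in> J \<Longrightarrow> \<forall>\<^sub>F s in nhds t. g s = g t"
    for s t and g :: "real \<Rightarrow> 'a"
    using \<open>connected J\<close> that(1,2)
  proof (rule connected_local_const)
    show "\<forall>t\<in>J. \<forall>\<^sub>F s in at t within J. g t = g s"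
      unfolding eventually_at_filter by (intro ballI eventually_mono[OF g]) auto
  qed
  have "D s = D t" if "s \<in> J" "t \<in> J" for s t
    using that by (rule const) (rule eventually_mono[OF nbhd], auto)
  then obtain u where u: "\<And>t. t \<in> J \<Longrightarrow> D t = u" by (metis)
  have shift: "f s - s *\<^sub>R u = f t - t *\<^sub>R u" if "s \<in> J" "t \<in> J" for s t
    using that
  proof (rule const)
    fix t assume t: "t \<in> J"
    show "\<forall>\<^sub>F s in nhds t. f s - s *\<^sub>R u = f t - t *\<^sub>R u"
      using nbhd[OF t] by eventually_elim (simp add: u[OF t] algebra_simps)
  qed
  have "f s = f t + (s - t) *\<^sub>R u" if "s \<in> J" "t \<in> J" for s t
    using shift[OF that] by (simp only: diff_scaleR_eq_iff)
  then show ?thesis by blast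
qed

section \<open>Local behaviour of a billiard trajectory\<close>

lemma open_cone_interior: "open (cone_interior a b)"
  unfolding cone_interior_def divide_inverse by (intro open_Collect_less continuous_intros)

lemma cone_disjoint_interior: "p \<in> elliptic_cone a b \<Longrightarrow> p \<notin> cone_interior a b"
  unfolding elliptic_cone_def cone_interior_def mem_Collect_eq
  by (metis abs_of_pos less_irrefl real_sqrt_abs)

lemma norm_reflect: "norm (reflect n u) = norm u"
proof -
  have "reflect n u \<bullet> reflect n u = u \<bullet> u"
    by (cases "n = 0") (simp_all add: reflect_def inner_diff inner_commute field_simps)
  then show ?thesis by (simp add: norm_eq)
qed

lemma inner_reflect: "x \<bullet> n = 0 \<Longrightarrow> x \<bullet> reflect n u = x \<bullet> u"
  by (simp add: reflect_def inner_diff)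

lemma norm_sq_line:
  assumes "norm u = 1"
  shows "(norm (p + (s - t) *\<^sub>R u))\<^sup>2 - s\<^sup>2 = (norm p)\<^sup>2 - t\<^sup>2 + (s - t) * (2 * (p \<bullet> u) - 2 * t)"
proof -
  have "(norm (p + r *\<^sub>R u))\<^sup>2 = (norm p)\<^sup>2 + 2 * r * (p \<bullet> u) + r\<^sup>2" for r
    using assms unfolding power2_norm_eq_inner norm_eq_1
    by (simp add: inner_add inner_commute power2_eq_square)
  from this[of "s - t"] show ?thesis by (simp add: power2_eq_square left_diff_distrib right_diff_distrib)
qed

text \<open>
  What the radial motion needs to know about a reflection: both velocities are unit vectors with the
  same inner product with the position, because the position is orthogonal to the normal of the cone.
\<close>

lemma reflects_at_two_sided:
  assumes "reflects_at a b x t"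
  obtains u w where "norm u = 1" "norm w = 1" "x t \<bullet> w = x t \<bullet> u"
    "\<forall>\<^sub>F s in at_left t. x s \<in> cone_interior a b \<and> x s = x t + (s - t) *\<^sub>R u"
    "\<forall>\<^sub>F s in at_right t. x s \<in> cone_interior a b \<and> x s = x t + (s - t) *\<^sub>R w"
proof -
  let ?n = "cone_normal a b (x t)"
  obtain u where "x t \<in> elliptic_cone a b" and u: "norm u = 1"
    "\<forall>\<^sub>F s in at_left t. x s \<in> cone_interior a b \<and> x s = x t + (s - t) *\<^sub>R u"
    "\<forall>\<^sub>F s in at_right t. x s \<in> cone_interior a b \<and> x s = x t + (s - t) *\<^sub>R reflect ?n u"
    using assms unfolding reflects_at_def by blast
  then have "x t \<bullet> reflect ?n u = x t \<bullet> u"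
    by (intro inner_reflect elliptic_cone_isotropic)
  moreover have "norm (reflect ?n u) = 1" using u(1) by (simp add: norm_reflect)
  ultimately show ?thesis using that[of u "reflect ?n u"] u by blast
qed

text \<open>
  For unit speed the quadratic term of \<open>\<bar>x(s)\<bar>\<^sup>2\<close> is \<open>s\<^sup>2\<close> on either side of \<open>t\<close>, and the linear
  terms agree since they involve the velocity only through \<open>x \<bullet> v\<close>. So a reflection is invisible to
  the distance from the apex.
\<close>

lemma norm_sq_locally_affine:
  assumes "moves_straight_at a b x t \<or> reflects_at a b x t"
  shows "\<exists>\<beta>. \<forall>\<^sub>F s in nhds t. (norm (x s))\<^sup>2 - s\<^sup>2 = (norm (x t))\<^sup>2 - t\<^sup>2 + (s - t) *\<^sub>R \<beta>"
  using assms
proof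
  assume "moves_straight_at a b x t"
  then obtain u where "norm u = 1" "\<forall>\<^sub>F s in at t. x s = x t + (s - t) *\<^sub>R u"
    by (auto simp: moves_straight_at_def)
  then have "\<forall>\<^sub>F s in at t. (norm (x s))\<^sup>2 - s\<^sup>2
      = (norm (x t))\<^sup>2 - t\<^sup>2 + (s - t) *\<^sub>R (2 * (x t \<bullet> u) - 2 * t)"
    by (auto elim!: eventually_mono simp: norm_sq_line)
  then show ?thesis unfolding eventually_nhds_conv_at by auto
next
  assume "reflects_at a b x t"
  then obtain u w where uw: "norm u = 1" "norm w = 1" "x t \<bullet> w = x t \<bullet> u"
    "\<forall>\<^sub>F s in at_left t. x s \<in> cone_interior a b \<and> x s = x t + (s - t) *\<^sub>R u"
    "\<forall>\<^sub>F s in at_right t. x s \<in> cone_interior a b \<and> x s = x t + (s - t) *\<^sub>R w"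
    by (rule reflects_at_two_sided)
  have "\<forall>\<^sub>F s in at t. (norm (x s))\<^sup>2 - s\<^sup>2
      = (norm (x t))\<^sup>2 - t\<^sup>2 + (s - t) *\<^sub>R (2 * (x t \<bullet> u) - 2 * t)"
    unfolding eventually_at_split
  proof
    show "\<forall>\<^sub>F s in at_left t. (norm (x s))\<^sup>2 - s\<^sup>2
        = (norm (x t))\<^sup>2 - t\<^sup>2 + (s - t) *\<^sub>R (2 * (x t \<bullet> u) - 2 * t)"
      using uw(4) by eventually_elim (simp add: norm_sq_line[OF uw(1)])
    show "\<forall>\<^sub>F s in at_right t. (norm (x s))\<^sup>2 - s\<^sup>2
        = (norm (x t))\<^sup>2 - t\<^sup>2 + (s - t) *\<^sub>R (2 * (x t \<bullet> u) - 2 * t)"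
      using uw(5) by eventually_elim (simp add: norm_sq_line[OF uw(2)] uw(3))
  qed
  then show ?thesis unfolding eventually_nhds_conv_at by auto
qed

lemma trajectory_isCont:
  assumes "moves_straight_at a b x t \<or> reflects_at a b x t"
  shows "isCont x t"
proof -
  have lim: "((\<lambda>s. x t + (s - t) *\<^sub>R u) \<longlongrightarrow> x t) (at t within S)" for u S
    by (auto intro!: tendsto_eq_intros)
  from assms have "(x \<longlongrightarrow> x t) (at t)"
  proof
    assume "moves_straight_at a b x t"
    then obtain u where "\<forall>\<^sub>F s in at t. x s = x t + (s - t) *\<^sub>R u"
      by (auto simp: moves_straight_at_def)
    then show ?thesis using lim[of u UNIV] by (simp add: tendsto_cong)
  next
    assume "reflects_at a b x t"
    then obtain u w where
      "\<forall>\<^sub>F s in at_left t. x s \<in> cone_interior a b \<and> x s = x t + (s - t) *\<^sub>R u"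
      "\<forall>\<^sub>F s in at_right t. x s \<in> cone_interior a b \<and> x s = x t + (s - t) *\<^sub>R w"
      by (rule reflects_at_two_sided)
    then have "\<forall>\<^sub>F s in at_left t. x s = x t + (s - t) *\<^sub>R u"
      "\<forall>\<^sub>F s in at_right t. x s = x t + (s - t) *\<^sub>R w"
      by (auto elim: eventually_mono)
    then have "(x \<longlongrightarrow> x t) (at_left t)" "(x \<longlongrightarrow> x t) (at_right t)"
      using lim by (simp_all add: tendsto_cong)
    then show ?thesis by (simp add: filterlim_at_split)
  qed
  then show ?thesis by (simp add: isCont_def)
qed

text \<open>
  Points of the cone are not in its interior, so this says that the reflection times are isolated in
  the time domain.
\<close>

lemma eventually_interior:
  assumes "moves_straight_at a b x t \<or> reflects_at a b x t"
  shows "\<forall>\<^sub>F s in at t. x s \<in> cone_interior a b"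
  using assms
proof
  assume m: "moves_straight_at a b x t"
  then have "isCont x t" using trajectory_isCont by blast
  then show ?thesis using m open_cone_interior
    by (auto simp: isCont_def moves_straight_at_def intro: topological_tendstoD)
next
  assume "reflects_at a b x t"
  then show ?thesis
    by (auto simp: reflects_at_def eventually_at_split elim: eventually_mono)
qed

section \<open>Global behaviour of a billiard trajectory\<close>

lemma exists_straight_time:
  assumes "billiard_trajectory a b J x"
  obtains t where "t \<in> J" "moves_straight_at a b x t"
proof -
  have J: "open J" and loc: "\<And>t. t \<in> J \<Longrightarrow> moves_straight_at a b x t \<or> reflects_at a b x t"
    using assms by (auto simp: billiard_trajectory_def)
  obtain t where t: "t \<in> J" using assms by (auto simp: billiard_trajectory_def)
  have "\<forall>\<^sub>F s in at t. s \<in> J" using J t by (rule eventually_at_in_open')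
  then have "\<forall>\<^sub>F s in at t. s \<in> J \<and> x s \<in> cone_interior a b"
    using eventually_interior[OF loc[OF t]] by eventually_elim simp
  then obtain s where "s \<in> J" "x s \<in> cone_interior a b"
    using eventually_happens'[OF at_neq_bot] by blast
  then show ?thesis using that loc[of s] cone_disjoint_interior by (auto simp: reflects_at_def)
qed

lemma straight_time_integrals:
  assumes "integrals_along a b J x c1 c2" "t \<in> J" "moves_straight_at a b x t"
    and "\<forall>\<^sub>F s in nhds t. x s = x t + (s - t) *\<^sub>R u"
  shows "I1 (x t) u = c1" "I2 a b (x t) u = c2"
proof -
  have "vector_derivative x (at t) = u"
    using assms(4) by (rule vector_derivative_locally_affine)
  moreover have "t \<notin> reflection_times a b J x"
    using assms(3) cone_disjoint_interior
    by (auto simp: reflection_times_def moves_straight_at_def reflects_at_def)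
  ultimately show "I1 (x t) u = c1" "I2 a b (x t) u = c2"
    using assms(1,2) by (auto simp: integrals_along_def)
qed

text \<open>
  As \<open>\<bar>x(t)\<bar>\<^sup>2 - t\<^sup>2\<close> is affine near every time, it is affine on the whole time domain, and one
  straight piece determines it. The constant left after completing the square is the squared
  distance from the apex to the line carrying that piece, and this is \<open>I1\<close>.
\<close>

lemma norm_sq_trajectory:
  assumes traj: "billiard_trajectory a b J x" and int: "integrals_along a b J x c1 c2"
  obtains t0 where "\<And>t. t \<in> J \<Longrightarrow> (norm (x t))\<^sup>2 = (t - t0)\<^sup>2 + c1"
proof -
  have J: "open J" "connected J"
    and loc: "\<And>t. t \<in> J \<Longrightarrow> moves_straight_at a b x t \<or> reflects_at a b x t"
    using traj by (auto simp: billiard_trajectory_def is_interval_connected)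
  obtain \<beta> where \<beta>: "\<And>s t. s \<in> J \<Longrightarrow> t \<in> J \<Longrightarrow>
      (norm (x s))\<^sup>2 - s\<^sup>2 = (norm (x t))\<^sup>2 - t\<^sup>2 + (s - t) *\<^sub>R \<beta>"
    using locally_affine_imp_affine[OF J(2), of "\<lambda>t. (norm (x t))\<^sup>2 - t\<^sup>2"]
      norm_sq_locally_affine[OF loc] by blast
  obtain t where t: "t \<in> J" "moves_straight_at a b x t"
    using exists_straight_time[OF traj] .
  then obtain u where u: "norm u = 1" "\<forall>\<^sub>F s in at t. x s = x t + (s - t) *\<^sub>R u"
    by (auto simp: moves_straight_at_def)
  then have I: "I1 (x t) u = c1"
    by (intro straight_time_integrals(1)[OF int t]) (simp add: eventually_nhds_conv_at)
  have "\<forall>\<^sub>F s in at t. s \<in> J" using J(1) t(1) by (rule eventually_at_in_open')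
  then have "\<forall>\<^sub>F s in at t. s \<noteq> t \<and> s \<in> J \<and> x s = x t + (s - t) *\<^sub>R u"
    using u(2) eventually_neq_at_within[of t t UNIV]
    by eventually_elim auto
  then obtain s where s: "s \<noteq> t" "s \<in> J" "x s = x t + (s - t) *\<^sub>R u"
    using eventually_happens'[OF at_neq_bot] by blast
  have "\<beta> = 2 * (x t \<bullet> u) - 2 * t"
    using \<beta>[OF s(2) t(1)] norm_sq_line[OF u(1), of "x t" s t] s(1,3) by simp
  then have "(norm (x r))\<^sup>2 - r\<^sup>2 = (norm (x t))\<^sup>2 - t\<^sup>2 + (r - t) * (2 * (x t \<bullet> u) - 2 * t)"
    if "r \<in> J" for r
    using \<beta>[OF that t(1)] by simp
  moreover have "(norm (x t))\<^sup>2 = (x t \<bullet> u)\<^sup>2 + c1" using I u(1) by (simp add: I1_eq)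
  moreover have "(r - (t - p))\<^sup>2 = r\<^sup>2 + p\<^sup>2 - t\<^sup>2 + (r - t) * (2 * p - 2 * t)" for r p
    by (simp add: power2_eq_square algebra_simps)
  ultimately have "(norm (x r))\<^sup>2 = (r - (t - x t \<bullet> u))\<^sup>2 + c1" if "r \<in> J" for r
    using that by (smt (verit))
  then show ?thesis using that by blast
qed

text \<open>
  The infimum of the later reflection times lies in the time domain, since it is enclosed by \<open>s\<close> and
  \<open>t\<close>. As reflections do not accumulate there, the infimum is attained and differs from \<open>s\<close>.
\<close>

lemma next_reflection:
  assumes traj: "billiard_trajectory a b J x"
    and s: "s \<in> reflection_times a b J x" and t: "t \<in> reflection_times a b J x" and "s < t"
  obtains r where "r \<in> reflection_times a b J x" "s < r" "r \<le> t"
    "\<And>\<tau>. s < \<tau> \<Longrightarrow> \<tau> < r \<Longrightarrow> \<tau> \<notin> reflection_times a b J x"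
proof -
  let ?R = "reflection_times a b J x"
  define A where "A = {\<tau> \<in> ?R. s < \<tau>}"
  define r where "r = Inf A"
  have A: "A \<noteq> {}" "bdd_below A" using t \<open>s < t\<close> by (auto simp: A_def intro!: bdd_belowI[of _ s])
  have "s \<le> r" unfolding r_def using A by (intro cInf_greatest) (auto simp: A_def)
  have "r \<le> t" unfolding r_def using A t \<open>s < t\<close> by (intro cInf_lower) (auto simp: A_def)
  have "r \<in> J" using s t \<open>s \<le> r\<close> \<open>r \<le> t\<close> traj
    by (auto simp: reflection_times_def billiard_trajectory_def intro: mem_is_interval_1_I)
  then have "\<forall>\<^sub>F \<tau> in at_right r. x \<tau> \<in> cone_interior a b"
    using eventually_interior[of a b x r] traj
    by (auto simp: billiard_trajectory_def eventually_at_split)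
  then have "\<forall>\<^sub>F \<tau> in at_right r. \<tau> \<notin> ?R"
    by eventually_elim (use cone_disjoint_interior in \<open>auto simp: reflection_times_def reflects_at_def\<close>)
  then obtain e where e: "e > r" "\<And>\<tau>. r < \<tau> \<Longrightarrow> \<tau> < e \<Longrightarrow> \<tau> \<notin> ?R"
    by (auto simp: eventually_at_right_field)
  obtain y where y: "y \<in> A" "y < e" using e(1) A by (metis r_def cInf_lessD)
  have "r \<le> y" unfolding r_def using A y by (intro cInf_lower) auto
  then have "r \<in> A" using e(2)[of y] y by (cases "r = y") (auto simp: A_def)
  moreover have "\<tau> \<notin> ?R" if "s < \<tau>" "\<tau> < r" for \<tau>
    using that A cInf_lower[of \<tau> A] by (auto simp: A_def r_def)
  ultimately show ?thesis using that \<open>r \<le> t\<close> by (auto simp: A_def)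
qed

text \<open>
  On the open time interval the position is affine by \<open>locally_affine_imp_affine\<close>; continuity
  extends the formula to both ends. The integrals are prescribed at interior times only, but they do
  not change when the base point moves along the line, so they may be evaluated at \<open>x s\<close>.
\<close>

lemma chord_between_reflections:
  assumes traj: "billiard_trajectory a b J x" and int: "integrals_along a b J x c1 c2"
    and s: "s \<in> J" and r: "r \<in> J" and "s < r"
    and free: "\<And>\<tau>. s < \<tau> \<Longrightarrow> \<tau> < r \<Longrightarrow> \<tau> \<notin> reflection_times a b J x"
  obtains u where "norm u = 1" "x r = x s + (r - s) *\<^sub>R u" "I1 (x s) u = c1" "I2 a b (x s) u = c2"
proof -
  have sub: "{s..r} \<subseteq> J"
    using traj s r by (auto simp: billiard_trajectory_def intro: mem_is_interval_1_I)
  have loc: "\<And>t. t \<in> J \<Longrightarrow> moves_straight_at a b x t \<or> reflects_at a b x t"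
    using traj by (auto simp: billiard_trajectory_def)
  have mv: "moves_straight_at a b x \<tau>" if "\<tau> \<in> {s<..<r}" for \<tau>
  proof -
    have "\<tau> \<in> J" using that sub by auto
    then show ?thesis using loc[of \<tau>] free[of \<tau>] that by (simp add: reflection_times_def)
  qed
  have "\<exists>u. \<forall>\<^sub>F t in nhds \<tau>. x t = x \<tau> + (t - \<tau>) *\<^sub>R u" if "\<tau> \<in> {s<..<r}" for \<tau>
    using mv[OF that] by (auto simp: moves_straight_at_def eventually_nhds_conv_at)
  then have "\<exists>u. \<forall>\<sigma>\<in>{s<..<r}. \<forall>\<tau>\<in>{s<..<r}. x \<sigma> = x \<tau> + (\<sigma> - \<tau>) *\<^sub>R u"
    by (intro locally_affine_imp_affine) simp_all
  then obtain u where u: "\<And>\<sigma> \<tau>. \<sigma> \<in> {s<..<r} \<Longrightarrow> \<tau> \<in> {s<..<r} \<Longrightarrow> x \<sigma> = x \<tau> + (\<sigma> - \<tau>) *\<^sub>R u"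
    by blast
  define m where "m = (s + r) / 2"
  have m: "m \<in> {s<..<r}" "m \<in> J" using \<open>s < r\<close> sub by (auto simp: m_def)
  have near: "\<forall>\<^sub>F \<sigma> in at m. \<sigma> \<in> {s<..<r}" using m by (intro eventually_at_in_open') auto
  then have "\<forall>\<^sub>F \<sigma> in at m. x \<sigma> = x m + (\<sigma> - m) *\<^sub>R u"
    by (rule eventually_mono) (rule u[OF _ m(1)])
  then have nearu: "\<forall>\<^sub>F \<sigma> in nhds m. x \<sigma> = x m + (\<sigma> - m) *\<^sub>R u"
    by (simp add: eventually_nhds_conv_at)
  have "norm u = 1"
  proof -
    obtain v where v: "norm v = 1" "\<forall>\<^sub>F \<sigma> in at m. x \<sigma> = x m + (\<sigma> - m) *\<^sub>R v"
      using mv[OF m(1)] by (auto simp: moves_straight_at_def)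
    have "\<forall>\<^sub>F \<sigma> in at m. \<sigma> \<noteq> m" by (rule eventually_neq_at_within)
    moreover have "\<forall>\<^sub>F \<sigma> in at m. x \<sigma> = x m + (\<sigma> - m) *\<^sub>R u"
      using nearu by (simp add: eventually_nhds_conv_at)
    ultimately have "\<forall>\<^sub>F \<sigma> in at m. \<sigma> \<noteq> m \<and> (\<sigma> - m) *\<^sub>R u = (\<sigma> - m) *\<^sub>R v"
      using v(2) by eventually_elim (metis add_left_imp_eq)
    then obtain \<sigma> where "\<sigma> \<noteq> m" "(\<sigma> - m) *\<^sub>R u = (\<sigma> - m) *\<^sub>R v"
      using eventually_happens'[OF at_neq_bot] by blast
    then show ?thesis using v(1) by simp
  qed
  have cont: "continuous_on {s..r} (\<lambda>\<sigma>. x \<sigma> - \<sigma> *\<^sub>R u)"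
    using sub trajectory_isCont[OF loc]
    by (intro continuous_intros continuous_at_imp_continuous_on) auto
  have cl: "x \<sigma> - \<sigma> *\<^sub>R u = x m - m *\<^sub>R u" if "\<sigma> \<in> {s..r}" for \<sigma>
  proof (rule continuous_constant_on_closure[where S = "{s<..<r}"])
    show "continuous_on (closure {s<..<r}) (\<lambda>\<sigma>. x \<sigma> - \<sigma> *\<^sub>R u)"
      using cont \<open>s < r\<close> by simp
    show "\<sigma> \<in> closure {s<..<r}" using that \<open>s < r\<close> by simp
    show "x \<tau> - \<tau> *\<^sub>R u = x m - m *\<^sub>R u" if "\<tau> \<in> {s<..<r}" for \<tau>
      using u[OF that m(1)] by (simp only: diff_scaleR_eq_iff)
  qed
  have xm: "x m = x s + (m - s) *\<^sub>R u" and xr: "x r = x s + (r - s) *\<^sub>R u"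
    using cl[of s] cl[of r] \<open>s < r\<close> by (simp_all flip: diff_scaleR_eq_iff)
  have "I1 (x m) u = c1" "I2 a b (x m) u = c2"
    using straight_time_integrals[OF int m(2) mv[OF m(1)] nearu] .
  then show ?thesis unfolding xm I1_shift I2_shift by (rule that[OF \<open>norm u = 1\<close> xr])
qed

lemma sin_arctan_diff:
  "sin (arctan x - arctan y) = (x - y) / (sqrt (1 + x\<^sup>2) * sqrt (1 + y\<^sup>2))"
  by (simp add: sin_diff sin_arctan cos_arctan diff_divide_distrib mult.commute)

text \<open>
  The function \<open>\<theta> t = arctan ((t - t0) / sqrt c1)\<close> is increasing, so it suffices to treat the first reflection \<open>r\<close> after \<open>s\<close>.
  By the formula for \<open>\<bar>x(t)\<bar>\<^sup>2\<close>, the sine of \<open>\<theta> r - \<theta> s\<close> is exactly the quantity estimated in \<open>chord_bound\<close>. If the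
  difference exceeds \<open>\<pi>/2\<close>, where the sine no longer controls the angle, the claim is clear because
  the arcsine does not exceed \<open>\<pi>/2\<close>.
\<close>

lemma reflection_angle_gap:
  assumes ab: "a > b" "b > 0" and c: "c1 > 0" "c2 > 0"
    and traj: "billiard_trajectory a b J x" and int: "integrals_along a b J x c1 c2"
    and t0: "\<And>t. t \<in> J \<Longrightarrow> (norm (x t))\<^sup>2 = (t - t0)\<^sup>2 + c1"
    and s: "s \<in> reflection_times a b J x" and t: "t \<in> reflection_times a b J x" and "s < t"
  shows "arcsin (2 * a * b * sqrt (c1 * c2) / (a\<^sup>2 * (b\<^sup>2 + 1) * c1 + (b\<^sup>2 + 1) * c2))
    \<le> arctan ((t - t0) / sqrt c1) - arctan ((s - t0) / sqrt c1)"
proof -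
  define K where "K = 2 * a * b * sqrt (c1 * c2) / (a\<^sup>2 * (b\<^sup>2 + 1) * c1 + (b\<^sup>2 + 1) * c2)"
  define \<theta> where "\<theta> \<tau> = arctan ((\<tau> - t0) / sqrt c1)" for \<tau>
  have mono: "\<theta> \<sigma> \<le> \<theta> \<tau>" if "\<sigma> \<le> \<tau>" for \<sigma> \<tau>
    unfolding \<theta>_def arctan_le_iff using that c by (intro divide_right_mono) auto
  have K: "0 < K" "K \<le> 1"
    using bound_argument_range[of a b c1 c2] ab c by (auto simp: K_def)
  obtain r where r: "r \<in> reflection_times a b J x" "s < r" "r \<le> t"
    and free: "\<And>\<tau>. s < \<tau> \<Longrightarrow> \<tau> < r \<Longrightarrow> \<tau> \<notin> reflection_times a b J x"
    using next_reflection[OF traj s t \<open>s < t\<close>] by metis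
  have J: "s \<in> J" "r \<in> J" and cone: "x s \<in> elliptic_cone a b" "x r \<in> elliptic_cone a b"
    using s r(1) by (auto simp: reflection_times_def reflects_at_def)
  obtain u where u: "norm u = 1" "x r = x s + (r - s) *\<^sub>R u" "I1 (x s) u = c1" "I2 a b (x s) u = c2"
    using chord_between_reflections[OF traj int J \<open>s < r\<close> free] by metis
  have *: "sqrt (1 + ((\<tau> - t0) / sqrt c1)\<^sup>2) = norm (x \<tau>) / sqrt c1" if "\<tau> \<in> J" for \<tau>
  proof -
    have "1 + ((\<tau> - t0) / sqrt c1)\<^sup>2 = (norm (x \<tau>) / sqrt c1)\<^sup>2"
      using c t0[OF that] by (simp add: power_divide field_simps)
    then show ?thesis using c by simp
  qed
  have rescale: "((r - t0) / e - (s - t0) / e) / (A / e * (B / e)) = (r - s) * e / (B * A)"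
    if "e \<noteq> 0" for e A B :: real
    using that by (cases "A = 0 \<or> B = 0") (auto simp: field_simps)
  have "sin (\<theta> r - \<theta> s) = ((r - t0) / sqrt c1 - (s - t0) / sqrt c1)
      / (norm (x r) / sqrt c1 * (norm (x s) / sqrt c1))"
    unfolding \<theta>_def sin_arctan_diff *[OF J(1)] *[OF J(2)] ..
  also have "\<dots> = (r - s) * sqrt c1 / (norm (x s) * norm (x r))"
    using rescale[of "sqrt c1"] c by simp
  finally have "K \<le> sin (\<theta> r - \<theta> s)"
    using chord_bound[OF ab c _ cone(1) _ u(3,4), of "r - s"] \<open>s < r\<close> cone(2) u(2)
    by (simp add: K_def)
  moreover have pos: "0 \<le> \<theta> r - \<theta> s"
    using mono[of s r] \<open>s < r\<close> by simp
  ultimately have "arcsin K \<le> \<theta> r - \<theta> s"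
  proof (cases "\<theta> r - \<theta> s \<le> pi / 2")
    case True
    then have "arcsin (sin (\<theta> r - \<theta> s)) = \<theta> r - \<theta> s"
      using pos by (intro arcsin_sin) auto
    then show ?thesis
      using arcsin_le_arcsin[of K "sin (\<theta> r - \<theta> s)"] \<open>K \<le> sin _\<close> K by simp
  next
    case False
    then show ?thesis using arcsin_ubound[of K] K by linarith
  qed
  also have "\<theta> r - \<theta> s \<le> \<theta> t - \<theta> s"
    using mono[OF r(3)] by simp
  finally show ?thesis by (simp add: K_def \<theta>_def)
qed

section \<open>Counting\<close>

text \<open>
  Numbering the cells of length \<open>\<delta>\<close> from \<open>l\<close> on, two elements of \<open>A\<close> never share a cell. As the
  values stay strictly below \<open>l + w\<close>, only the cells with numbers below \<open>\<lceil>w / \<delta>\<rceil>\<close> are used.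
\<close>

lemma card_separated_le:
  fixes f :: "'a \<Rightarrow> real"
  assumes "\<delta> > 0" and range: "\<And>x. x \<in> A \<Longrightarrow> l < f x \<and> f x < l + w"
    and sep: "\<And>x y. x \<in> A \<Longrightarrow> y \<in> A \<Longrightarrow> x \<noteq> y \<Longrightarrow> \<delta> \<le> \<bar>f x - f y\<bar>"
    and "0 \<le> w"
  shows "finite A \<and> int (card A) \<le> \<lceil>w / \<delta>\<rceil>"
proof -
  define g where "g x = \<lfloor>(f x - l) / \<delta>\<rfloor>" for x
  have inj: "inj_on g A"
  proof (rule inj_onI, rule ccontr)
    fix x y assume xy: "x \<in> A" "y \<in> A" "g x = g y" "x \<noteq> y"
    have "\<bar>(f x - l) / \<delta> - (f y - l) / \<delta>\<bar> < 1"
      using xy(3) unfolding g_def by linarith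
    then have "\<bar>f x - f y\<bar> < \<delta>"
      using \<open>\<delta> > 0\<close> by (simp add: diff_divide_distrib[symmetric] abs_divide)
    then show False using sep[OF xy(1,2,4)] by simp
  qed
  have sub: "g ` A \<subseteq> {0..<\<lceil>w / \<delta>\<rceil>}"
  proof safe
    fix x assume "x \<in> A"
    then have "0 \<le> (f x - l) / \<delta>" "(f x - l) / \<delta> < w / \<delta>"
      using range[of x] \<open>\<delta> > 0\<close> by (auto intro!: divide_strict_right_mono)
    then show "g x \<in> {0..<\<lceil>w / \<delta>\<rceil>}"
      unfolding g_def atLeastLessThan_iff by linarith
  qed
  have "finite A" using inj sub by (meson finite_atLeastLessThan_int finite_imageD finite_subset)
  moreover have "card A \<le> card {0..<\<lceil>w / \<delta>\<rceil>}"
    using inj sub by (metis card_image card_mono finite_atLeastLessThan_int)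
  moreover have "0 \<le> \<lceil>w / \<delta>\<rceil>"
    using \<open>0 \<le> w\<close> \<open>\<delta> > 0\<close> by (simp add: order.strict_trans2[of "-1" 0])
  ultimately show ?thesis by (simp del: zero_le_ceiling)
qed

theorem theorem2:
  fixes a b c1 c2 :: real and J :: "real set" and x :: "real \<Rightarrow> real^3"
  assumes "a > b" and "b > 0"
    and "c1 > 0" and "c2 > 0"
    and "billiard_trajectory a b J x"
    and "integrals_along a b J x c1 c2"
  shows "finite (reflection_times a b J x) \<and>
    int (card (reflection_times a b J x)) \<le>
      \<lceil>pi / arcsin (2 * a * b * sqrt (c1 * c2) / (a\<^sup>2 * (b\<^sup>2 + 1) * c1 + (b\<^sup>2 + 1) * c2))\<rceil>"
proof -
  obtain t0 where t0: "\<And>t. t \<in> J \<Longrightarrow> (norm (x t))\<^sup>2 = (t - t0)\<^sup>2 + c1"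
    using norm_sq_trajectory[OF assms(5,6)] by metis
  note gap = reflection_angle_gap[OF assms t0]
  show ?thesis
  proof (rule card_separated_le[where f = "\<lambda>t. arctan ((t - t0) / sqrt c1)" and l = "- (pi / 2)"])
    show "0 < arcsin (2 * a * b * sqrt (c1 * c2) / (a\<^sup>2 * (b\<^sup>2 + 1) * c1 + (b\<^sup>2 + 1) * c2))"
      using bound_argument_range[of a b c1 c2] assms(1-4) arcsin_less_arcsin[of 0] by simp
    show "- (pi / 2) < arctan ((t - t0) / sqrt c1) \<and> arctan ((t - t0) / sqrt c1) < - (pi / 2) + pi"
      for t using arctan_bounded[of "(t - t0) / sqrt c1"] by simp
    show "arcsin (2 * a * b * sqrt (c1 * c2) / (a\<^sup>2 * (b\<^sup>2 + 1) * c1 + (b\<^sup>2 + 1) * c2))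
        \<le> \<bar>arctan ((s - t0) / sqrt c1) - arctan ((t - t0) / sqrt c1)\<bar>"
      if "s \<in> reflection_times a b J x" "t \<in> reflection_times a b J x" "s \<noteq> t" for s t
      using gap[of s t] gap[of t s] that by (cases "s < t") auto
  qed simp
qed

end
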